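(* Let $X$ be a countably infinite set. Let $\sigma:\mathrm{Cl}_{loc}(X)\to\mathrm{Cl}_{fpart}(X)$ be the mapping which sends every local clone $\mathscr C$ to the partial clone of all restrictions of operations of $\mathscr C$ to finite domains. Then $\sigma$ is one-to-one and preserves arbitrary joins.
   Context: For $n\ge 1$, let $\mathscr O^{(n)}=X^{X^n}$ be the set of $n$-ary operations on $X$ and $\mathscr O=\bigcup_{n\ge1}\mathscr O^{(n)}$. A clone on $X$ is a subset of $\mathscr O$ that contains all projections $\pi^n_k(x_1,\dots,x_n)=x_k$ ($1\le k\le n$) and is closed under composition: if $f$ is an $n$-ary member and $g_1,\dots,g_n$ are $m$-ary members, then $f(g_1,\dots,g_n)$ is a member. Equip $X$ with the discrete topology and each $\mathscr O^{(n)}=X^{X^n}$ with the product topology. A clone $\mathscr C$ is local (locally closed) iff $\mathscr C\cap\mathscr O^{(n)}$ is closed in $\mathscr O^{(n)}$ for every $n\ge1$. $\mathrm{Cl}_{loc}(X)$ is the complete lattice of all local clones on $X$ ordered by inclusion. A partial clone of finite operations on $X$ is a set of partial operations with finite domain on $X$ (i.e. functions from a finite subset of $X^n$ to $X$, for some $n\ge1$) which contains all restrictions of the projections to finite domains and which is closed under composition of partial operations. $\mathrm{Cl}_{fpart}(X)$ is the complete (algebraic) lattice of all partial clones of finite operations on $X$, ordered by inclusion. *)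

theory Defs
  imports "HOL-Analysis.Function_Topology" "HOL-Algebra.Complete_Lattice"
begin

text \<open>
  Elements of $X^n$ are lists of length $n$ over $X$. Operations carry their arity explicitly:
  a set of operations is a set of pairs \<open>(n, f)\<close>, where \<open>f\<close> is extensional on $X^n$
  (total operations) or a map whose domain is contained in $X^n$ (partial operations).
  Without the arity component, a function that is constantly \<open>undefined\<close> would be
  an operation of every arity. For a partial operation the arity component only matters for the
  empty map, and the empty map of each arity lies in every partial clone, being a restriction of
  a projection.
\<close>

definition tuples :: "'a set \<Rightarrow> nat \<Rightarrow> 'a list set" where
  "tuples X n = {xs. length xs = n \<and> set xs \<subseteq> X}"


subsection \<open>Clones and local clones\<close>

definition ops :: "'a set \<Rightarrow> nat \<Rightarrow> ('a list \<Rightarrow> 'a) set" where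
  "ops X n = tuples X n \<rightarrow>\<^sub>E X"

definition all_ops :: "'a set \<Rightarrow> (nat \<times> ('a list \<Rightarrow> 'a)) set" where
  "all_ops X = (SIGMA n:{1..}. ops X n)"

text \<open>Coordinates are numbered from 0, so the projections of arity \<open>n\<close> are those with \<open>k < n\<close>.\<close>

definition proj :: "'a set \<Rightarrow> nat \<Rightarrow> nat \<Rightarrow> 'a list \<Rightarrow> 'a" where
  "proj X n k = (\<lambda>xs\<in>tuples X n. xs ! k)"

definition compose_ops ::
  "'a set \<Rightarrow> nat \<Rightarrow> ('a list \<Rightarrow> 'a) \<Rightarrow> ('a list \<Rightarrow> 'a) list \<Rightarrow> 'a list \<Rightarrow> 'a" where
  "compose_ops X m f gs = (\<lambda>xs\<in>tuples X m. f (map (\<lambda>g. g xs) gs))"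

definition clone :: "'a set \<Rightarrow> (nat \<times> ('a list \<Rightarrow> 'a)) set \<Rightarrow> bool" where
  "clone X C \<longleftrightarrow>
     C \<subseteq> all_ops X \<and>
     (\<forall>n\<ge>1. \<forall>k<n. (n, proj X n k) \<in> C) \<and>
     (\<forall>n m f gs. (n, f) \<in> C \<and> length gs = n \<and> (\<forall>g\<in>set gs. (m, g) \<in> C)
        \<longrightarrow> (m, compose_ops X m f gs) \<in> C)"

definition op_topology :: "'a set \<Rightarrow> nat \<Rightarrow> ('a list \<Rightarrow> 'a) topology" where
  "op_topology X n = product_topology (\<lambda>_. discrete_topology X) (tuples X n)"

text \<open>For a clone \<open>C\<close>, the image \<open>C `` {n}\<close> is the set of its \<open>n\<close>-ary members.\<close>

definition local_clone :: "'a set \<Rightarrow> (nat \<times> ('a list \<Rightarrow> 'a)) set \<Rightarrow> bool" where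
  "local_clone X C \<longleftrightarrow> clone X C \<and> (\<forall>n\<ge>1. closedin (op_topology X n) (C `` {n}))"

definition Cl_loc :: "'a set \<Rightarrow> (nat \<times> ('a list \<Rightarrow> 'a)) set gorder" where
  "Cl_loc X = \<lparr>carrier = {C. local_clone X C}, eq = (=), le = (\<subseteq>)\<rparr>"


subsection \<open>Partial clones of finite operations\<close>

definition fpart_ops :: "'a set \<Rightarrow> (nat \<times> ('a list \<rightharpoonup> 'a)) set" where
  "fpart_ops X = {(n, f). n \<ge> 1 \<and> finite (dom f) \<and> dom f \<subseteq> tuples X n \<and> ran f \<subseteq> X}"

definition restrict_op :: "('a list \<Rightarrow> 'a) \<Rightarrow> 'a list set \<Rightarrow> 'a list \<rightharpoonup> 'a" where
  "restrict_op f A = (\<lambda>xs. Some (f xs)) |` A"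

text \<open>
  The composite is defined at a tuple iff all inner operations are defined there and the outer
  operation is defined at the tuple of their values. It is only used for a nonempty list of
  inner operations.
\<close>

definition compose_partial ::
  "('a list \<rightharpoonup> 'a) \<Rightarrow> ('a list \<rightharpoonup> 'a) list \<Rightarrow> 'a list \<rightharpoonup> 'a" where
  "compose_partial f gs =
     (\<lambda>xs. if \<forall>g\<in>set gs. xs \<in> dom g then f (map (\<lambda>g. the (g xs)) gs) else None)"

definition fpart_clone :: "'a set \<Rightarrow> (nat \<times> ('a list \<rightharpoonup> 'a)) set \<Rightarrow> bool" where
  "fpart_clone X P \<longleftrightarrow>
     P \<subseteq> fpart_ops X \<and>
     (\<forall>n\<ge>1. \<forall>k<n. \<forall>A. finite A \<and> A \<subseteq> tuples X n \<longrightarrow> (n, restrict_op (proj X n k) A) \<in> P) \<and>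
     (\<forall>n m f gs. (n, f) \<in> P \<and> length gs = n \<and> (\<forall>g\<in>set gs. (m, g) \<in> P)
        \<longrightarrow> (m, compose_partial f gs) \<in> P)"

definition Cl_fpart :: "'a set \<Rightarrow> (nat \<times> ('a list \<rightharpoonup> 'a)) set gorder" where
  "Cl_fpart X = \<lparr>carrier = {P. fpart_clone X P}, eq = (=), le = (\<subseteq>)\<rparr>"


subsection \<open>The map sending a local clone to its finite restrictions\<close>

definition finite_restrictions ::
  "'a set \<Rightarrow> (nat \<times> ('a list \<Rightarrow> 'a)) set \<Rightarrow> (nat \<times> ('a list \<rightharpoonup> 'a)) set" where
  "finite_restrictions X C =
     {(n, restrict_op f A) | n f A. (n, f) \<in> C \<and> finite A \<and> A \<subseteq> tuples X n}"

end

theory Submission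
  imports Defs "HOL-Algebra.Galois_Connection"
begin

text \<open>
  Write \<open>\<sigma>\<close> for the map sending a local clone to its finite restrictions. In the other direction,
  send a partial clone \<open>P\<close> to \<open>\<tau> P\<close>, the set of all total operations all of whose finite restrictions
  lie in \<open>P\<close> (\<open>interpolated_ops\<close> below). The theorem holds because \<open>(\<sigma>, \<tau>)\<close> is a Galois
  connection with \<open>\<tau> \<circ> \<sigma> = id\<close>: a lower adjoint preserves every join, and a map with a left inverse
  is injective.

  The inclusion \<open>\<sigma> C \<subseteq> P\<close> holds iff \<open>C \<subseteq> \<tau> P\<close>, since both say that all finite restrictions of members of \<open>C\<close>
  lie in \<open>P\<close>. What needs work is that the maps land in the right places and that \<open>\<tau>\<close> undoes \<open>\<sigma>\<close>:

  \<^item> \<open>\<sigma> C\<close> is a partial clone because the composite of restrictions of \<open>f, g\<^sub>1, \<dots>, g\<^sub>n\<close>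
    is a restriction of \<open>f(g\<^sub>1, \<dots>, g\<^sub>n)\<close> (\<open>fpart_clone_finite_restrictions\<close>).

  \<^item> \<open>\<tau> P\<close> is a clone because every finite restriction of \<open>f(g\<^sub>1, \<dots>, g\<^sub>n)\<close> is a composite of
    finite restrictions of \<open>f, g\<^sub>1, \<dots>, g\<^sub>n\<close>: the inner operations map a finite set of tuples to
    a finite set of tuples (\<open>restrict_compose_ops\<close>). It is local: if \<open>f\<close> is not in \<open>\<tau> P\<close>, then
    its restriction to some finite set \<open>A\<close> is not in \<open>P\<close>, and the operations agreeing with \<open>f\<close> on \<open>A\<close>
    form a neighbourhood of \<open>f\<close> outside of \<open>\<tau> P\<close> (\<open>closedin_interpolated_ops\<close>).

  \<^item> \<open>\<tau> (\<sigma> C)\<close> consists of the operations that agree on every finite set with some member of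
    \<open>C\<close>. This is the topological closure of \<open>C\<close>, hence \<open>C\<close> itself when \<open>C\<close> is local
    (\<open>interpolated_ops_finite_restrictions\<close>).
\<close>

section \<open>Lattices of sets and adjoint maps\<close>

lemma partial_order_inclusion:
  "partial_order \<lparr>carrier = S, eq = (=), le = (\<subseteq>)\<rparr>"
  by unfold_locales auto

text \<open>
  A closure system containing a largest set is a complete lattice; the meet of a nonempty family
  is its intersection and the meet of the empty family is the largest set.
\<close>

lemma complete_lattice_closure_system:
  assumes top: "U \<in> S" "\<And>A. A \<in> S \<Longrightarrow> A \<subseteq> U"
    and Int: "\<And>F. F \<subseteq> S \<Longrightarrow> F \<noteq> {} \<Longrightarrow> \<Inter>F \<in> S"
  shows "complete_lattice \<lparr>carrier = S, eq = (=), le = (\<subseteq>)\<rparr>" (is "complete_lattice ?L")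
proof -
  interpret partial_order ?L
    by (rule partial_order_inclusion)
  show ?thesis
  proof (rule complete_lattice_criterion1)
    show "\<exists>g. greatest ?L g (carrier ?L)"
      using top by (auto simp: greatest_def)
    show "\<exists>i. greatest ?L i (Lower ?L A)" if "A \<subseteq> carrier ?L" "A \<noteq> {}" for A
    proof
      show "greatest ?L (\<Inter>A) (Lower ?L A)"
        using that Int[of A] by (auto simp: greatest_def Lower_def)
    qed
  qed
qed

text \<open>
  The image of a join lies below every upper bound of the images, since the upper adjoint
  carries such a bound back to an upper bound of the family.
\<close>

lemma (in galois_connection) lower_sup_pres:
  assumes "complete_lattice \<X>" "complete_lattice \<Y>"
  shows "sup_pres \<X> \<Y> \<pi>\<^sup>*"
proof -
  interpret X: complete_lattice \<X> by fact
  interpret Y: complete_lattice \<Y> by fact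
  have "\<pi>\<^sup>* (\<Squnion>\<^bsub>\<X>\<^esub> A) = \<Squnion>\<^bsub>\<Y>\<^esub> (\<pi>\<^sup>* ` A)" if A: "A \<subseteq> carrier \<X>" for A
  proof (rule Y.le_antisym)
    have A': "\<pi>\<^sup>* ` A \<subseteq> carrier \<Y>"
      using A lower_closed by blast
    show c: "\<pi>\<^sup>* (\<Squnion>\<^bsub>\<X>\<^esub> A) \<in> carrier \<Y>" "\<Squnion>\<^bsub>\<Y>\<^esub> (\<pi>\<^sup>* ` A) \<in> carrier \<Y>"
      using A A' by (simp_all add: lower_closed)
    have "x \<sqsubseteq>\<^bsub>\<X>\<^esub> \<pi>\<^sub>* (\<Squnion>\<^bsub>\<Y>\<^esub> (\<pi>\<^sup>* ` A))" if "x \<in> A" for x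
      using that A A' c by (intro right Y.sup_upper) auto
    then have "\<Squnion>\<^bsub>\<X>\<^esub> A \<sqsubseteq>\<^bsub>\<X>\<^esub> \<pi>\<^sub>* (\<Squnion>\<^bsub>\<Y>\<^esub> (\<pi>\<^sup>* ` A))"
      using A c by (intro X.sup_least) (auto intro: upper_closed)
    then show "\<pi>\<^sup>* (\<Squnion>\<^bsub>\<X>\<^esub> A) \<sqsubseteq>\<^bsub>\<Y>\<^esub> \<Squnion>\<^bsub>\<Y>\<^esub> (\<pi>\<^sup>* ` A)"
      using A c by (intro left) auto
    have "\<pi>\<^sup>* x \<sqsubseteq>\<^bsub>\<Y>\<^esub> \<pi>\<^sup>* (\<Squnion>\<^bsub>\<X>\<^esub> A)" if "x \<in> A" for x
      using that A by (intro use_iso2[OF lower_iso] X.sup_upper) auto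
    then show "\<Squnion>\<^bsub>\<Y>\<^esub> (\<pi>\<^sup>* ` A) \<sqsubseteq>\<^bsub>\<Y>\<^esub> \<pi>\<^sup>* (\<Squnion>\<^bsub>\<X>\<^esub> A)"
      using A' c by (intro Y.sup_least) auto
  qed
  then show ?thesis
    using assms by (simp add: sup_pres_def)
qed


section \<open>Operations and their finite restrictions\<close>

lemma map_ops_in_tuples:
  assumes "\<forall>g\<in>set gs. g \<in> ops X m" "xs \<in> tuples X m"
  shows "map (\<lambda>g. g xs) gs \<in> tuples X (length gs)"
  using assms by (auto simp: tuples_def ops_def PiE_iff)

lemma clone_compose:
  assumes "clone X C" "(n, f) \<in> C" "length gs = n" "\<forall>g\<in>set gs. (m, g) \<in> C"
  shows "(m, compose_ops X m f gs) \<in> C"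
  using assms by (simp add: clone_def)

lemma fpart_clone_compose:
  assumes "fpart_clone X P" "(n, f) \<in> P" "length gs = n" "\<forall>g\<in>set gs. (m, g) \<in> P"
  shows "(m, compose_partial f gs) \<in> P"
  using assms by (simp add: fpart_clone_def)

lemma clone_all_ops: "clone X (all_ops X)"
  unfolding clone_def
proof (intro conjI allI impI)
  show "(n, proj X n k) \<in> all_ops X" if "n \<ge> 1" "k < n" for n k
    using that by (auto simp: all_ops_def ops_def proj_def tuples_def subset_iff)
  show "(m, compose_ops X m f gs) \<in> all_ops X"
    if "(n, f) \<in> all_ops X \<and> length gs = n \<and> (\<forall>g\<in>set gs. (m, g) \<in> all_ops X)" for n m f gs
  proof -
    have "gs \<noteq> []" "m \<ge> 1"
      using that by (cases gs; auto simp: all_ops_def)+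
    moreover have "compose_ops X m f gs \<in> ops X m"
      using that map_ops_in_tuples[of gs X m]
      by (auto simp: all_ops_def ops_def compose_ops_def PiE_iff)
    ultimately show ?thesis
      by (simp add: all_ops_def)
  qed
qed simp

lemma restrict_op_apply:
  "restrict_op f A xs = (if xs \<in> A then Some (f xs) else None)"
  by (simp add: restrict_op_def)

lemma dom_restrict_op [simp]: "dom (restrict_op f A) = A"
  by (auto simp: restrict_op_def)

lemma ran_restrict_op: "ran (restrict_op f A) = f ` A"
  by (auto simp: ran_def restrict_op_apply)

lemma finite_restrictions_iff:
  "(n, p) \<in> finite_restrictions X C \<longleftrightarrow>
     finite (dom p) \<and> dom p \<subseteq> tuples X n \<and> (\<exists>f. (n, f) \<in> C \<and> (\<forall>xs\<in>dom p. p xs = Some (f xs)))"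
  (is "?L \<longleftrightarrow> ?R")
proof
  assume ?L
  then show ?R
    by (auto simp: finite_restrictions_def restrict_op_apply split: if_splits)
next
  assume R: ?R
  then obtain f where f: "(n, f) \<in> C" "\<forall>xs\<in>dom p. p xs = Some (f xs)"
    by blast
  have "p = restrict_op f (dom p)"
    using f(2) by (auto simp: restrict_op_apply fun_eq_iff)
  with f R show ?L
    unfolding finite_restrictions_def by blast
qed

text \<open>
  On a finite set, composing total operations and then restricting is the same as composing finite
  restrictions, once the outer operation is restricted to the finitely many tuples of inner values.
  There has to be an inner operation, since it is the domains of the inner operations that confine the
  composite on the right to \<open>A\<close>.
\<close>

lemma restrict_compose_ops:
  assumes "gs \<noteq> []" "A \<subseteq> tuples X m"
  shows "restrict_op (compose_ops X m f gs) A =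
    compose_partial (restrict_op f ((\<lambda>xs. map (\<lambda>g. g xs) gs) ` A)) (map (\<lambda>g. restrict_op g A) gs)"
proof
  fix xs
  show "restrict_op (compose_ops X m f gs) A xs =
    compose_partial (restrict_op f ((\<lambda>xs. map (\<lambda>g. g xs) gs) ` A)) (map (\<lambda>g. restrict_op g A) gs) xs"
  proof (cases "xs \<in> A")
    case True
    then have "xs \<in> tuples X m"
      using assms by blast
    moreover have "map (\<lambda>h. the (h xs)) (map (\<lambda>g. restrict_op g A) gs) = map (\<lambda>g. g xs) gs"
      using True by (simp add: restrict_op_apply)
    ultimately show ?thesis
      using True
      by (auto simp add: compose_partial_def compose_ops_def restrict_op_apply domIff simp del: map_map)
  next
    case False
    then show ?thesis
      using assms by (simp add: compose_partial_def restrict_op_apply)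
  qed
qed

lemma dom_compose_partialD:
  assumes "xs \<in> dom (compose_partial f gs)" "g \<in> set gs"
  shows "xs \<in> dom g"
  using assms by (auto simp: compose_partial_def split: if_splits)

lemma dom_compose_partial_subset:
  assumes "gs \<noteq> []" "\<And>g. g \<in> set gs \<Longrightarrow> finite (dom g) \<and> dom g \<subseteq> T"
  shows "finite (dom (compose_partial f gs))" "dom (compose_partial f gs) \<subseteq> T"
proof -
  have "dom (compose_partial f gs) \<subseteq> dom (hd gs)"
    using assms(1) by (meson dom_compose_partialD hd_in_set subsetI)
  then show "finite (dom (compose_partial f gs))" "dom (compose_partial f gs) \<subseteq> T"
    using assms(2)[of "hd gs"] assms(1) by (auto intro: finite_subset)
qed

lemma fpart_clone_fpart_ops: "fpart_clone X (fpart_ops X)"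
  unfolding fpart_clone_def
proof (intro conjI allI impI)
  show "(n, restrict_op (proj X n k) A) \<in> fpart_ops X"
    if "n \<ge> 1" "k < n" "finite A \<and> A \<subseteq> tuples X n" for n k A
  proof -
    have "ran (restrict_op (proj X n k) A) \<subseteq> X"
      using that by (auto simp: ran_restrict_op proj_def tuples_def subset_iff)
    then show ?thesis
      using that by (simp add: fpart_ops_def)
  qed
  show "(m, compose_partial f gs) \<in> fpart_ops X"
    if "(n, f) \<in> fpart_ops X \<and> length gs = n \<and> (\<forall>g\<in>set gs. (m, g) \<in> fpart_ops X)" for n m f gs
  proof -
    have "gs \<noteq> []" "m \<ge> 1"
      using that by (cases gs; auto simp: fpart_ops_def)+
    moreover have "ran (compose_partial f gs) \<subseteq> ran f"
      by (auto simp: ran_def compose_partial_def)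
    ultimately show ?thesis
      using that dom_compose_partial_subset[of gs "tuples X m" f]
      by (auto simp: fpart_ops_def)
  qed
qed simp


section \<open>The two maps\<close>

lemma fpart_clone_finite_restrictions:
  assumes "clone X C"
  shows "fpart_clone X (finite_restrictions X C)"
  unfolding fpart_clone_def
proof (intro conjI allI impI)
  have sub: "C \<subseteq> all_ops X"
    using assms by (simp add: clone_def)
  show "finite_restrictions X C \<subseteq> fpart_ops X"
  proof (clarify)
    fix n p
    assume "(n, p) \<in> finite_restrictions X C"
    then obtain f A where p: "p = restrict_op f A" "(n, f) \<in> C" "finite A" "A \<subseteq> tuples X n"
      by (auto simp: finite_restrictions_def)
    then have "f \<in> ops X n" "n \<ge> 1"
      using sub by (auto simp: all_ops_def)
    then have "f ` A \<subseteq> X"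
      using p(4) by (auto simp: ops_def)
    then show "(n, p) \<in> fpart_ops X"
      using p \<open>n \<ge> 1\<close> by (simp add: fpart_ops_def ran_restrict_op)
  qed
  show "(n, restrict_op (proj X n k) A) \<in> finite_restrictions X C"
    if "n \<ge> 1" "k < n" "finite A \<and> A \<subseteq> tuples X n" for n k A
  proof -
    have "(n, proj X n k) \<in> C"
      using assms that by (simp add: clone_def)
    then show ?thesis
      using that unfolding finite_restrictions_def by blast
  qed
  show "(m, compose_partial f gs) \<in> finite_restrictions X C"
    if *: "(n, f) \<in> finite_restrictions X C \<and> length gs = n \<and>
        (\<forall>g\<in>set gs. (m, g) \<in> finite_restrictions X C)" for n m f gs
  proof -
    obtain F where F: "(n, F) \<in> C" "\<forall>xs\<in>dom f. f xs = Some (F xs)"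
      using * by (auto simp: finite_restrictions_iff)
    have "\<forall>g\<in>set gs. \<exists>h. (m, h) \<in> C \<and> (\<forall>xs\<in>dom g. g xs = Some (h xs))"
      using * by (simp add: finite_restrictions_iff)
    then obtain G where G: "\<forall>g\<in>set gs. (m, G g) \<in> C \<and> (\<forall>xs\<in>dom g. g xs = Some (G g xs))"
      by (rule bchoice[THEN exE])
    have "gs \<noteq> []"
      using F * sub by (auto simp: all_ops_def)
    moreover have "\<And>g. g \<in> set gs \<Longrightarrow> finite (dom g) \<and> dom g \<subseteq> tuples X m"
      using * by (simp add: finite_restrictions_iff)
    ultimately have dom: "finite (dom (compose_partial f gs))" "dom (compose_partial f gs) \<subseteq> tuples X m"
      using dom_compose_partial_subset[of gs "tuples X m" f] by blast+
    have "(m, compose_ops X m F (map G gs)) \<in> C"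
    proof -
      have "\<forall>g\<in>set (map G gs). (m, g) \<in> C" "length (map G gs) = n"
        using G * by simp_all
      then show ?thesis
        using clone_compose[OF assms F(1)] by blast
    qed
    moreover have "compose_partial f gs xs = Some (compose_ops X m F (map G gs) xs)"
      if xs: "xs \<in> dom (compose_partial f gs)" for xs
    proof -
      have all: "\<forall>g\<in>set gs. xs \<in> dom g"
        using dom_compose_partialD[OF xs] by simp
      then have "g xs = Some (G g xs)" if "g \<in> set gs" for g
        using G that by blast
      then have "map (\<lambda>g. the (g xs)) gs = map (\<lambda>g. G g xs) gs"
        by (intro map_cong refl) (metis option.sel)
      then have eq: "compose_partial f gs xs = f (map (\<lambda>g. G g xs) gs)"
        using all by (simp add: compose_partial_def del: map_eq_conv)
      then have "map (\<lambda>g. G g xs) gs \<in> dom f"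
        using xs by (auto simp: domIff)
      then show ?thesis
        using eq F(2) xs dom(2) by (auto simp: compose_ops_def comp_def)
    qed
    ultimately show ?thesis
      using dom unfolding finite_restrictions_iff by blast
  qed
qed

definition interpolated_ops ::
  "'a set \<Rightarrow> (nat \<times> ('a list \<rightharpoonup> 'a)) set \<Rightarrow> (nat \<times> ('a list \<Rightarrow> 'a)) set" where
  "interpolated_ops X P =
     {(n, f) \<in> all_ops X. \<forall>A. finite A \<and> A \<subseteq> tuples X n \<longrightarrow> (n, restrict_op f A) \<in> P}"

lemma clone_interpolated_ops:
  assumes P: "fpart_clone X P"
  shows "clone X (interpolated_ops X P)"
  unfolding clone_def
proof (intro conjI allI impI)
  show "interpolated_ops X P \<subseteq> all_ops X"
    by (auto simp: interpolated_ops_def)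
  show "(n, proj X n k) \<in> interpolated_ops X P" if "n \<ge> 1" "k < n" for n k
    using that P clone_all_ops[of X]
    by (auto simp: interpolated_ops_def clone_def fpart_clone_def)
  show "(m, compose_ops X m f gs) \<in> interpolated_ops X P"
    if *: "(n, f) \<in> interpolated_ops X P \<and> length gs = n \<and>
        (\<forall>g\<in>set gs. (m, g) \<in> interpolated_ops X P)" for n m f gs
  proof -
    have all: "(n, f) \<in> all_ops X \<and> length gs = n \<and> (\<forall>g\<in>set gs. (m, g) \<in> all_ops X)"
      using * by (auto simp: interpolated_ops_def)
    then have "(m, compose_ops X m f gs) \<in> all_ops X"
      using clone_compose[OF clone_all_ops] by blast
    moreover have "(m, restrict_op (compose_ops X m f gs) A) \<in> P"
      if A: "finite A" "A \<subseteq> tuples X m" for A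
    proof -
      define B where "B = (\<lambda>xs. map (\<lambda>g. g xs) gs) ` A"
      have "gs \<noteq> []" "\<forall>g\<in>set gs. g \<in> ops X m"
        using all by (auto simp: all_ops_def)
      then have "B \<subseteq> tuples X n" "finite B"
        using A all map_ops_in_tuples[of gs X m] by (auto simp: B_def)
      then have "(n, restrict_op f B) \<in> P"
        using * by (auto simp: interpolated_ops_def)
      moreover have "\<forall>g\<in>set (map (\<lambda>g. restrict_op g A) gs). (m, g) \<in> P"
        using * A by (auto simp: interpolated_ops_def)
      moreover have "length (map (\<lambda>g. restrict_op g A) gs) = n"
        using all by simp
      ultimately have "(m, compose_partial (restrict_op f B) (map (\<lambda>g. restrict_op g A) gs)) \<in> P"
        using fpart_clone_compose[OF P] by blast
      then show ?thesis
        using restrict_compose_ops[OF \<open>gs \<noteq> []\<close> A(2)] by (simp add: B_def)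
    qed
    ultimately show ?thesis
      by (simp add: interpolated_ops_def)
  qed
qed

section \<open>Local closure\<close>

lemma topspace_op_topology: "topspace (op_topology X n) = ops X n"
  by (simp add: op_topology_def ops_def)

text \<open>
  This lemma and the next one say that the sets of operations agreeing with \<open>f\<close> on a finite set
  form a neighbourhood base at \<open>f\<close>, which turns local closedness into a statement about finite restrictions.
\<close>

lemma openin_agree:
  assumes "finite A" "A \<subseteq> tuples X n" "f \<in> ops X n"
  shows "openin (op_topology X n) {g \<in> ops X n. \<forall>xs\<in>A. g xs = f xs}"
proof -
  have "{g \<in> ops X n. \<forall>xs\<in>A. g xs = f xs} =
      (\<Pi>\<^sub>E xs\<in>tuples X n. if xs \<in> A then {f xs} else X)"
    (is "?L = ?R")
  proof (intro equalityI subsetI)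
    show "g \<in> ?R" if "g \<in> ?L" for g
      using that by (auto simp: ops_def PiE_iff)
    show "g \<in> ?L" if g: "g \<in> ?R" for g
    proof -
      have "g xs \<in> X" if "xs \<in> tuples X n" for xs
        using PiE_mem[OF g that] that assms(3) by (auto simp: ops_def split: if_splits)
      moreover have "g xs = f xs" if "xs \<in> A" for xs
        using PiE_mem[OF g, of xs] that assms(2) by auto
      ultimately show ?thesis
        using g by (simp add: ops_def PiE_iff)
    qed
  qed
  moreover have "openin (op_topology X n) \<dots>"
    unfolding op_topology_def
  proof (rule product_topology_basis)
    show "openin (discrete_topology X) (if xs \<in> A then {f xs} else X)" for xs
      using assms(2,3) by (auto simp: ops_def)
    show "finite {xs. (if xs \<in> A then {f xs} else X) \<noteq> topspace (discrete_topology X)}"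
      by (rule finite_subset[OF _ assms(1)]) auto
  qed
  ultimately show ?thesis
    by simp
qed

lemma openin_contains_agree:
  assumes "openin (op_topology X n) T" "f \<in> T"
  obtains A where "finite A" "A \<subseteq> tuples X n"
    "\<And>g. g \<in> ops X n \<Longrightarrow> \<forall>xs\<in>A. g xs = f xs \<Longrightarrow> g \<in> T"
proof -
  obtain U where U: "f \<in> (\<Pi>\<^sub>E xs\<in>tuples X n. U xs)"
      "finite {xs. U xs \<noteq> topspace (discrete_topology X)}" "(\<Pi>\<^sub>E xs\<in>tuples X n. U xs) \<subseteq> T"
    using product_topology_open_contains_basis[OF assms[unfolded op_topology_def]] by metis
  (* A is the set of coordinates that the basic box around f constrains. *)
  show ?thesis
  proof
    show "finite ({xs. U xs \<noteq> X} \<inter> tuples X n)"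
      using U(2) by simp
    show "g \<in> T" if "g \<in> ops X n" "\<forall>xs\<in>{xs. U xs \<noteq> X} \<inter> tuples X n. g xs = f xs" for g
    proof -
      have "g xs \<in> U xs" if "xs \<in> tuples X n" for xs
        using that \<open>g \<in> ops X n\<close> \<open>\<forall>xs\<in>_. g xs = f xs\<close> U(1)
        by (cases "U xs = X") (auto simp: ops_def PiE_iff)
      then have "g \<in> (\<Pi>\<^sub>E xs\<in>tuples X n. U xs)"
        using \<open>g \<in> ops X n\<close> by (simp add: ops_def PiE_iff)
      then show ?thesis
        using U(3) by blast
    qed
  qed simp
qed

lemma closedin_interpolated_ops:
  assumes "n \<ge> 1"
  shows "closedin (op_topology X n) (interpolated_ops X P `` {n})"
  unfolding closedin_def
proof (intro conjI)
  show "interpolated_ops X P `` {n} \<subseteq> topspace (op_topology X n)"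
    by (auto simp: interpolated_ops_def all_ops_def topspace_op_topology)
  show "openin (op_topology X n) (topspace (op_topology X n) - interpolated_ops X P `` {n})"
  proof (subst openin_subopen, intro ballI)
    fix f
    assume "f \<in> topspace (op_topology X n) - interpolated_ops X P `` {n}"
    then obtain A where f: "f \<in> ops X n"
      and A: "finite A" "A \<subseteq> tuples X n" "(n, restrict_op f A) \<notin> P"
      using assms by (auto simp: interpolated_ops_def all_ops_def topspace_op_topology)
    have "g \<notin> interpolated_ops X P `` {n}" if "\<forall>xs\<in>A. g xs = f xs" for g
    proof -
      have "restrict_op g A = restrict_op f A"
        using that by (auto simp: restrict_op_apply fun_eq_iff)
      then show ?thesis
        using A by (auto simp: interpolated_ops_def)
    qed
    then show "\<exists>T. openin (op_topology X n) T \<and> f \<in> T \<and>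
        T \<subseteq> topspace (op_topology X n) - interpolated_ops X P `` {n}"
      using openin_agree[OF A(1,2) f] f
      by (intro exI[of _ "{g \<in> ops X n. \<forall>xs\<in>A. g xs = f xs}"]) (auto simp: topspace_op_topology)
  qed
qed

lemma local_clone_interpolated_ops:
  "fpart_clone X P \<Longrightarrow> local_clone X (interpolated_ops X P)"
  by (simp add: local_clone_def clone_interpolated_ops closedin_interpolated_ops)

lemma finite_restrictions_subset_iff:
  assumes "C \<subseteq> all_ops X"
  shows "finite_restrictions X C \<subseteq> P \<longleftrightarrow> C \<subseteq> interpolated_ops X P"
  using assms unfolding finite_restrictions_def interpolated_ops_def by blast

text \<open>
  A member \<open>f\<close> of the left-hand side agrees with members of \<open>C\<close> on all finite sets, so every neighbourhood
  of \<open>f\<close> meets \<open>C\<close>, and \<open>f\<close> lies in \<open>C\<close> as \<open>C\<close> is closed.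
\<close>

lemma interpolated_ops_finite_restrictions:
  assumes "local_clone X C"
  shows "interpolated_ops X (finite_restrictions X C) = C"
proof
  have sub: "C \<subseteq> all_ops X"
    using assms by (simp add: local_clone_def clone_def)
  then show "C \<subseteq> interpolated_ops X (finite_restrictions X C)"
    using finite_restrictions_subset_iff by blast
  show "interpolated_ops X (finite_restrictions X C) \<subseteq> C"
  proof (clarify)
    fix n f
    assume nf: "(n, f) \<in> interpolated_ops X (finite_restrictions X C)"
    then have n: "n \<ge> 1" and f: "f \<in> ops X n"
      by (auto simp: interpolated_ops_def all_ops_def)
    have "f \<in> op_topology X n closure_of (C `` {n})"
      unfolding in_closure_of topspace_op_topology
    proof (intro conjI allI impI f)
      fix T
      assume "f \<in> T \<and> openin (op_topology X n) T"
      then obtain A where A: "finite A" "A \<subseteq> tuples X n"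
        and T: "\<And>g. g \<in> ops X n \<Longrightarrow> \<forall>xs\<in>A. g xs = f xs \<Longrightarrow> g \<in> T"
        using openin_contains_agree by metis
      have "(n, restrict_op f A) \<in> finite_restrictions X C"
        using nf A by (auto simp: interpolated_ops_def)
      then obtain g where "(n, g) \<in> C" "\<forall>xs\<in>A. g xs = f xs"
        by (auto simp: finite_restrictions_iff restrict_op_apply)
      then show "\<exists>g. g \<in> C `` {n} \<and> g \<in> T"
        using T sub by (auto simp: all_ops_def)
    qed
    moreover have "closedin (op_topology X n) (C `` {n})"
      using assms n by (simp add: local_clone_def)
    ultimately show "(n, f) \<in> C"
      by (simp add: closure_of_closedin)
  qed
qed


section \<open>The lattices and the adjunction\<close>

lemma clone_Inter:
  assumes "\<And>C. C \<in> F \<Longrightarrow> clone X C" "F \<noteq> {}"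
  shows "clone X (\<Inter>F)"
  unfolding clone_def
proof (intro conjI allI impI InterI)
  have "C \<subseteq> all_ops X" if "C \<in> F" for C
    using assms(1)[OF that] by (simp add: clone_def)
  then show "\<Inter>F \<subseteq> all_ops X"
    using assms(2) by blast
  show "(n, proj X n k) \<in> C" if "n \<ge> 1" "k < n" "C \<in> F" for n k C
    using assms(1) that by (simp add: clone_def)
  show "(m, compose_ops X m f gs) \<in> C"
    if "(n, f) \<in> \<Inter>F \<and> length gs = n \<and> (\<forall>g\<in>set gs. (m, g) \<in> \<Inter>F)" "C \<in> F" for n m f gs C
    using that by (intro clone_compose[OF assms(1)[OF \<open>C \<in> F\<close>], of n]) auto
qed

lemma local_clone_Inter:
  assumes "\<And>C. C \<in> F \<Longrightarrow> local_clone X C" "F \<noteq> {}"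
  shows "local_clone X (\<Inter>F)"
proof -
  have "closedin (op_topology X n) ((\<Inter>F) `` {n})" if "n \<ge> 1" for n
  proof -
    have "(\<Inter>F) `` {n} = \<Inter> ((\<lambda>C. C `` {n}) ` F)"
      by auto
    moreover have "closedin (op_topology X n) \<dots>"
      using assms that by (intro closedin_Inter) (auto simp: local_clone_def)
    ultimately show ?thesis
      by simp
  qed
  then show ?thesis
    using assms by (simp add: local_clone_def clone_Inter)
qed

lemma fpart_clone_Inter:
  assumes "\<And>P. P \<in> F \<Longrightarrow> fpart_clone X P" "F \<noteq> {}"
  shows "fpart_clone X (\<Inter>F)"
  unfolding fpart_clone_def
proof (intro conjI allI impI InterI)
  have "P \<subseteq> fpart_ops X" if "P \<in> F" for P
    using assms(1)[OF that] by (simp add: fpart_clone_def)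
  then show "\<Inter>F \<subseteq> fpart_ops X"
    using assms(2) by blast
  show "(n, restrict_op (proj X n k) A) \<in> P"
    if "n \<ge> 1" "k < n" "finite A \<and> A \<subseteq> tuples X n" "P \<in> F" for n k A P
    using assms(1) that by (simp add: fpart_clone_def)
  show "(m, compose_partial f gs) \<in> P"
    if "(n, f) \<in> \<Inter>F \<and> length gs = n \<and> (\<forall>g\<in>set gs. (m, g) \<in> \<Inter>F)" "P \<in> F" for n m f gs P
    using that by (intro fpart_clone_compose[OF assms(1)[OF \<open>P \<in> F\<close>], of n]) auto
qed

lemma local_clone_all_ops: "local_clone X (all_ops X)"
proof -
  have "closedin (op_topology X n) (all_ops X `` {n})" if "n \<ge> 1" for n
  proof -
    have "all_ops X `` {n} = topspace (op_topology X n)"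
      using that by (auto simp: all_ops_def topspace_op_topology)
    then show ?thesis
      by simp
  qed
  then show ?thesis
    by (simp add: local_clone_def clone_all_ops)
qed

lemma complete_lattice_Cl_loc: "complete_lattice (Cl_loc X)"
  unfolding Cl_loc_def
proof (rule complete_lattice_closure_system)
  show "all_ops X \<in> {C. local_clone X C}"
    by (simp add: local_clone_all_ops)
  show "A \<subseteq> all_ops X" if "A \<in> {C. local_clone X C}" for A
    using that by (simp add: local_clone_def clone_def)
  show "\<Inter>F \<in> {C. local_clone X C}" if "F \<subseteq> {C. local_clone X C}" "F \<noteq> {}" for F
    using that by (auto intro!: local_clone_Inter)
qed

lemma complete_lattice_Cl_fpart: "complete_lattice (Cl_fpart X)"
  unfolding Cl_fpart_def
proof (rule complete_lattice_closure_system)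
  show "fpart_ops X \<in> {P. fpart_clone X P}"
    by (simp add: fpart_clone_fpart_ops)
  show "A \<subseteq> fpart_ops X" if "A \<in> {P. fpart_clone X P}" for A
    using that by (simp add: fpart_clone_def)
  show "\<Inter>F \<in> {P. fpart_clone X P}" if "F \<subseteq> {P. fpart_clone X P}" "F \<noteq> {}" for F
    using that by (auto intro!: fpart_clone_Inter)
qed

lemma retract_finite_restrictions:
  "retract \<lparr>orderA = Cl_loc X, orderB = Cl_fpart X,
     lower = finite_restrictions X, upper = interpolated_ops X\<rparr>"
proof (intro retract.intro galois_connection.intro connection.intro
    galois_connection_axioms.intro retract_axioms.intro, simp_all)
  show "partial_order (Cl_loc X)" "partial_order (Cl_fpart X)"
    by (simp_all add: Cl_loc_def Cl_fpart_def partial_order_inclusion)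
  show "finite_restrictions X \<in> carrier (Cl_loc X) \<rightarrow> carrier (Cl_fpart X)"
    by (auto simp: Cl_loc_def Cl_fpart_def local_clone_def fpart_clone_finite_restrictions)
  show "interpolated_ops X \<in> carrier (Cl_fpart X) \<rightarrow> carrier (Cl_loc X)"
    by (auto simp: Cl_loc_def Cl_fpart_def local_clone_interpolated_ops)
  show "finite_restrictions X C \<sqsubseteq>\<^bsub>Cl_fpart X\<^esub> P \<longleftrightarrow> C \<sqsubseteq>\<^bsub>Cl_loc X\<^esub> interpolated_ops X P"
    if "C \<in> carrier (Cl_loc X)" for C P
    using that finite_restrictions_subset_iff[of C X P]
    by (simp add: Cl_loc_def Cl_fpart_def local_clone_def clone_def)
  show "interpolated_ops X (finite_restrictions X C) \<sqsubseteq>\<^bsub>Cl_loc X\<^esub> C"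
    if "C \<in> carrier (Cl_loc X)" for C
    using that by (simp add: Cl_loc_def interpolated_ops_finite_restrictions)
qed

theorem theorem8:
  fixes X :: "'a set"
  assumes "countable X" and "infinite X"
  shows "finite_restrictions X \<in> carrier (Cl_loc X) \<rightarrow> carrier (Cl_fpart X)
    \<and> inj_on (finite_restrictions X) (carrier (Cl_loc X))
    \<and> sup_pres (Cl_loc X) (Cl_fpart X) (finite_restrictions X)"
proof -
  interpret \<sigma>: retract "\<lparr>orderA = Cl_loc X, orderB = Cl_fpart X,
      lower = finite_restrictions X, upper = interpolated_ops X\<rparr>"
    by (rule retract_finite_restrictions)
  have "sup_pres (Cl_loc X) (Cl_fpart X) (finite_restrictions X)"
    using \<sigma>.lower_sup_pres by (simp add: complete_lattice_Cl_loc complete_lattice_Cl_fpart)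
  then show ?thesis
    using \<sigma>.lower_closure \<sigma>.retract_injective by simp
qed

end
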